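(* Let $N \ge 1$, let $\mathbf{J} = \{J_x\}_{x=0}^{N-1}$ be nonnegative real coupling constants, let $\mathbf{h} = \{h_x\}_{x=0}^{N}$ be arbitrary real external fields (of any signs), and let $i<j$ be two points of $\{0,\ldots,N\}$. Let $h'_i, h'_j \in \mathbb{R}$ be the effective fields at $i$ and $j$ obtained by integrating out all spins at sites outside $\{i,\ldots,j\}$. Then $$\operatorname{cov}_{\mathbf{J},\mathbf{h}}(\sigma_i,\sigma_j) \le \left( \prod_{x=i}^{j-1} \frac{4\tanh(J_x)}{(1+\tanh(J_x))^2} \right) \frac{4\, e^{-2\left| h'_i + \sum_{x=i+1}^{j-1} h_x + h'_j \right|}}{\left( 1 + e^{-2\left( |h'_i| + \sum_{x=i+1}^{j-1} |h_x| + |h'_j| \right)} \right)^2}.$$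
   Context: One-dimensional Ising model on $\{0,\ldots,N\}$ with free boundary conditions: for a spin configuration $\boldsymbol{\sigma} = (\sigma_0,\ldots,\sigma_N) \in \{\pm1\}^{N+1}$ put $$H_{\mathbf{J},\mathbf{h}}(\boldsymbol{\sigma}) = -\sum_{x=0}^{N-1} J_x \sigma_x\sigma_{x+1} - \sum_{x=0}^{N} h_x\sigma_x.$$ The Gibbs measure is $\mu_{\mathbf{J},\mathbf{h}}(\boldsymbol{\sigma}) = \exp(-H_{\mathbf{J},\mathbf{h}}(\boldsymbol{\sigma}))/Z_{\mathbf{J},\mathbf{h}}$, where $Z_{\mathbf{J},\mathbf{h}} = \sum_{\boldsymbol{\sigma}\in\{\pm1\}^{N+1}} \exp(-H_{\mathbf{J},\mathbf{h}}(\boldsymbol{\sigma}))$, and $\operatorname{cov}_{\mathbf{J},\mathbf{h}}$ denotes covariance under $\mu_{\mathbf{J},\mathbf{h}}$. Effective fields: for $i<j$, $h'_i$ and $h'_j$ are the (unique) real numbers such that the marginal of $\mu_{\mathbf{J},\mathbf{h}}$ on $(\sigma_i,\ldots,\sigma_j)$ equals the Gibbs measure on $\{\pm1\}^{j-i+1}$ proportional to $$\exp\left( \sum_{x=i}^{j-1} J_x\sigma_x\sigma_{x+1} + h'_i\sigma_i + \sum_{x=i+1}^{j-1} h_x\sigma_x + h'_j\sigma_j \right).$$ In particular $h'_i=h_i$ if $i=0$ and $h'_j=h_j$ if $j=N$. Empty sums are $0$. *)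

theory Defs
  imports "HOL-Probability.Probability"
begin

text \<open>The chain lives on a general segment \<open>{a..b}\<close> of sites, so that the same Gibbs measure
  serves for \<open>{0..N}\<close> and for its marginals. Configurations are extensional, i.e.
  \<open>undefined\<close> outside the segment, so they correspond one-to-one to \<open>{-1, 1}\<^sup>b\<^sup>-\<^sup>a\<^sup>+\<^sup>1\<close>.\<close>

definition spin_configs :: "nat \<Rightarrow> nat \<Rightarrow> (nat \<Rightarrow> real) set" where
  "spin_configs a b = ({a..b} \<rightarrow>\<^sub>E {-1, 1})"

definition hamiltonian ::
    "nat \<Rightarrow> nat \<Rightarrow> (nat \<Rightarrow> real) \<Rightarrow> (nat \<Rightarrow> real) \<Rightarrow> (nat \<Rightarrow> real) \<Rightarrow> real" where
  "hamiltonian a b J h \<sigma> =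
     - (\<Sum>x\<in>{a..<b}. J x * \<sigma> x * \<sigma> (x + 1)) - (\<Sum>x\<in>{a..b}. h x * \<sigma> x)"

definition partition_function ::
    "nat \<Rightarrow> nat \<Rightarrow> (nat \<Rightarrow> real) \<Rightarrow> (nat \<Rightarrow> real) \<Rightarrow> real" where
  "partition_function a b J h = (\<Sum>\<sigma>\<in>spin_configs a b. exp (- hamiltonian a b J h \<sigma>))"

definition gibbs ::
    "nat \<Rightarrow> nat \<Rightarrow> (nat \<Rightarrow> real) \<Rightarrow> (nat \<Rightarrow> real) \<Rightarrow> (nat \<Rightarrow> real) pmf" where
  "gibbs a b J h = embed_pmf (\<lambda>\<sigma>. indicator (spin_configs a b) \<sigma> *
     (exp (- hamiltonian a b J h \<sigma>) / partition_function a b J h))"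

lemma finite_spin_configs: "finite (spin_configs a b)"
  unfolding spin_configs_def by (intro finite_PiE) auto

lemma spin_configs_nonempty: "spin_configs a b \<noteq> {}"
  unfolding spin_configs_def by (simp add: PiE_eq_empty_iff)

lemma partition_function_pos: "partition_function a b J h > 0"
  unfolding partition_function_def
  by (intro sum_pos finite_spin_configs spin_configs_nonempty) auto

text \<open>The side conditions of \<^const>\<open>embed_pmf\<close> hold, hence \<^const>\<open>gibbs\<close> has the intended weights.\<close>

lemma pmf_gibbs:
  "pmf (gibbs a b J h) \<sigma> =
     (if \<sigma> \<in> spin_configs a b
      then exp (- hamiltonian a b J h \<sigma>) / partition_function a b J h else 0)"
proof -
  let ?f = "\<lambda>\<sigma>. indicator (spin_configs a b) \<sigma> *
     (exp (- hamiltonian a b J h \<sigma>) / partition_function a b J h) :: real"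
  have Z: "partition_function a b J h > 0"
    by (rule partition_function_pos)
  have nonneg: "?f \<tau> \<ge> 0" for \<tau>
    using Z by simp
  have "(\<integral>\<^sup>+\<tau>. ennreal (?f \<tau>) \<partial>count_space UNIV)
      = (\<Sum>\<tau>\<in>spin_configs a b. ennreal (?f \<tau>))"
    by (rule nn_integral_count_space'[OF finite_spin_configs]) auto
  also have "\<dots> = ennreal (\<Sum>\<tau>\<in>spin_configs a b. ?f \<tau>)"
    by (rule sum_ennreal) (rule nonneg)
  also have "(\<Sum>\<tau>\<in>spin_configs a b. ?f \<tau>)
      = (\<Sum>\<tau>\<in>spin_configs a b. exp (- hamiltonian a b J h \<tau>)) / partition_function a b J h"
    by (simp add: sum_divide_distrib)
  also have "\<dots> = 1"
    using Z by (simp add: partition_function_def)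
  finally have "(\<integral>\<^sup>+\<tau>. ennreal (?f \<tau>) \<partial>count_space UNIV) = 1"
    by simp
  from pmf_embed_pmf[OF nonneg this] show ?thesis
    unfolding gibbs_def by simp
qed

definition covariance :: "'a pmf \<Rightarrow> ('a \<Rightarrow> real) \<Rightarrow> ('a \<Rightarrow> real) \<Rightarrow> real" where
  "covariance p X Y = measure_pmf.expectation p
     (\<lambda>\<omega>. (X \<omega> - measure_pmf.expectation p X) * (Y \<omega> - measure_pmf.expectation p Y))"

text \<open>The marginal on \<open>(\<sigma>\<^sub>i, \<dots>, \<sigma>\<^sub>j)\<close> is again an Ising chain with the same couplings, where
  only the fields at the two end sites are changed to \<open>hi'\<close> and \<open>hj'\<close>.\<close>

definition effective_fields ::
    "nat \<Rightarrow> (nat \<Rightarrow> real) \<Rightarrow> (nat \<Rightarrow> real) \<Rightarrow> nat \<Rightarrow> nat \<Rightarrow> real \<Rightarrow> real \<Rightarrow> bool" where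
  "effective_fields N J h i j hi' hj' \<longleftrightarrow>
     map_pmf (\<lambda>\<sigma>. restrict \<sigma> {i..j}) (gibbs 0 N J h) = gibbs i j J (h(i := hi', j := hj'))"

end

theory Submission
  imports Defs
begin

text \<open>Passing to the marginal on \<open>{i..j}\<close> leaves the covariance unchanged, so the two spins may be
  taken to be the end spins of a chain. Let \<open>W u v\<close> be the part of the partition function \<open>Z\<close>
  carried by the configurations with end spins \<open>u\<close> and \<open>v\<close>. For two variables with
  values in \<open>{-1, 1}\<close> the covariance is four times the determinant of their joint law, that is
  \<open>4 det W / Z\<^sup>2\<close>. As a matrix, \<open>W\<close> is an alternating product of field matrices
  \<open>diag (exp (h x)) (exp (- h x))\<close>, whose determinant is 1, and of coupling matrices with entries
  \<open>exp (J x * u * v)\<close>, whose determinant is \<open>2 sinh (2 J x)\<close>. Hence the covariance is exactly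
  \<open>4 (\<Prod>x. 2 sinh (2 J x)) / Z\<^sup>2\<close>, and the fields enter only through \<open>Z\<close>
  (lemma \<open>covariance_end_spins\<close>).

  Since \<open>J x \<ge> 0\<close> the numerator is nonnegative, so it remains to bound
  \<open>Z\<close> from below, and keeping only the two constant configurations is enough
  (lemma \<open>partition_function_ge_constant_spins\<close>): with \<open>s\<close> the sum of the fields they contribute
  \<open>exp (\<Sum>x. J x) * (exp s + exp (- s))\<close>. The factors \<open>exp (2 J x)\<close> in the square of this bound turn
  \<open>2 sinh (2 J x)\<close> into \<open>4 tanh (J x) / (1 + tanh (J x))\<^sup>2\<close>. Moreover
  \<open>exp s + exp (- s) = exp \<bar>s\<bar> * (1 + exp (- 2 * \<bar>s\<bar>))\<close>, and the last exponential only
  decreases when \<open>\<bar>s\<bar>\<close> is replaced by the sum of the absolute values of the fields.\<close>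

section \<open>Growing the chain by one site\<close>

lemma sum_spin_configs_singleton:
  fixes F :: "(nat \<Rightarrow> real) \<Rightarrow> real"
  shows "(\<Sum>\<sigma>\<in>spin_configs a a. F \<sigma>)
    = F (\<lambda>x\<in>{a}. 1) + F (\<lambda>x\<in>{a}. -1)"
proof -
  have ne: "(\<lambda>x\<in>{a}. 1 :: real) \<noteq> (\<lambda>x\<in>{a}. -1)"
    by (auto simp: fun_eq_iff)
  have "spin_configs a a = {\<lambda>x\<in>{a}. 1, \<lambda>x\<in>{a}. -1}"
  proof (intro set_eqI iffI)
    fix \<sigma> :: "nat \<Rightarrow> real"
    assume s: "\<sigma> \<in> spin_configs a a"
    then have "\<sigma> = (\<lambda>x\<in>{a}. \<sigma> a)" "\<sigma> a = 1 \<or> \<sigma> a = -1"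
      by (auto simp: spin_configs_def PiE_iff extensional_def fun_eq_iff)
    then show "\<sigma> \<in> {\<lambda>x\<in>{a}. 1, \<lambda>x\<in>{a}. -1}"
      by (metis insertCI)
  qed (auto simp: spin_configs_def split: if_splits)
  with ne show ?thesis
    by simp
qed

lemma sum_spin_configs_Suc:
  fixes F :: "(nat \<Rightarrow> real) \<Rightarrow> real"
  assumes "a \<le> b"
  shows "(\<Sum>\<sigma>\<in>spin_configs a (Suc b). F \<sigma>)
    = (\<Sum>\<sigma>\<in>spin_configs a b. F (\<sigma>(Suc b := 1)) + F (\<sigma>(Suc b := -1)))"
proof -
  have ins: "{a..Suc b} = insert (Suc b) {a..b}"
    using assms by auto
  have inj: "inj_on (\<lambda>(v, \<sigma>). \<sigma>(Suc b := v)) ({-1, 1} \<times> spin_configs a b)"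
    unfolding spin_configs_def by (rule inj_combinator) auto
  have "(\<Sum>\<sigma>\<in>spin_configs a (Suc b). F \<sigma>)
      = (\<Sum>(v, \<sigma>)\<in>{-1, 1} \<times> spin_configs a b. F (\<sigma>(Suc b := v)))"
    unfolding spin_configs_def ins PiE_insert_eq
    by (subst sum.reindex[OF inj[unfolded spin_configs_def]])
      (auto intro!: sum.cong)
  also have "\<dots> = (\<Sum>\<sigma>\<in>spin_configs a b. F (\<sigma>(Suc b := 1)) + F (\<sigma>(Suc b := -1)))"
    unfolding sum.cartesian_product[symmetric] by (simp add: sum.distrib)
  finally show ?thesis .
qed

lemma hamiltonian_Suc:
  assumes "a \<le> b"
  shows "hamiltonian a (Suc b) J h (\<sigma>(Suc b := v))
    = hamiltonian a b J h \<sigma> - (J b * \<sigma> b * v + h (Suc b) * v)"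
proof -
  have "(\<Sum>x\<in>{a..b}. h x * (\<sigma>(Suc b := v)) x) = (\<Sum>x\<in>{a..b}. h x * \<sigma> x)"
    and "(\<Sum>x\<in>{a..<b}. J x * (\<sigma>(Suc b := v)) x * (\<sigma>(Suc b := v)) (x + 1))
      = (\<Sum>x\<in>{a..<b}. J x * \<sigma> x * \<sigma> (x + 1))"
    by (auto intro!: sum.cong)
  with assms show ?thesis
    by (simp add: hamiltonian_def)
qed

section \<open>Transfer matrices and the covariance of the end spins\<close>

definition pinned_partition_function ::
    "nat \<Rightarrow> nat \<Rightarrow> (nat \<Rightarrow> real) \<Rightarrow> (nat \<Rightarrow> real) \<Rightarrow> real \<Rightarrow> real \<Rightarrow> real" where
  "pinned_partition_function a b J h u v =
     (\<Sum>\<sigma>\<in>spin_configs a b.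
        if \<sigma> a = u \<and> \<sigma> b = v then exp (- hamiltonian a b J h \<sigma>) else 0)"

lemma pinned_partition_function_singleton:
  assumes "u \<in> {-1, 1}"
  shows "pinned_partition_function a a J h u v = (if u = v then exp (h a * u) else 0)"
  using assms unfolding pinned_partition_function_def sum_spin_configs_singleton
  by (auto simp: hamiltonian_def)

text \<open>The spin at the old right end takes one of two values, and summing over it is the
  multiplication by the transfer matrix of the new bond.\<close>

lemma pinned_partition_function_Suc:
  assumes "a \<le> b" and "v \<in> {-1, 1}"
  shows "pinned_partition_function a (Suc b) J h u v
    = (pinned_partition_function a b J h u 1 * exp (J b * v)
       + pinned_partition_function a b J h u (-1) * exp (- J b * v)) * exp (h (Suc b) * v)"
proof -
  have spin: "\<sigma> b = 1 \<or> \<sigma> b = -1" if "\<sigma> \<in> spin_configs a b" for \<sigma>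
    using that assms(1) by (auto simp: spin_configs_def PiE_iff)
  have "a \<noteq> Suc b"
    using assms(1) by simp
  with assms spin show ?thesis
    unfolding pinned_partition_function_def sum_spin_configs_Suc[OF assms(1)]
      hamiltonian_Suc[OF assms(1)] sum_distrib_right sum.distrib[symmetric]
    by (intro sum.cong refl) (fastforce simp: exp_add[symmetric] algebra_simps)
qed

text \<open>Determinants multiply along the chain. The two entries of a diagonal field matrix are
  inverse to each other, so it drops out; a coupling matrix contributes \<open>exp (2 J x) - exp (- 2 J x)\<close>.\<close>

lemma det_pinned_partition_function:
  assumes "a \<le> b"
  shows "pinned_partition_function a b J h 1 1 * pinned_partition_function a b J h (-1) (-1)
      - pinned_partition_function a b J h 1 (-1) * pinned_partition_function a b J h (-1) 1
    = (\<Prod>x\<in>{a..<b}. 2 * sinh (2 * J x))"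
  using assms
proof (induction b rule: dec_induct)
  case base
  show ?case
    by (simp add: pinned_partition_function_singleton exp_add[symmetric])
next
  case (step b)
  let ?W = "pinned_partition_function a b J h"
  define x y where "x = exp (J b)" and "y = exp (h (Suc b))"
  have nz: "x \<noteq> 0" "y \<noteq> 0"
    by (simp_all add: x_def y_def)
  have sinh: "2 * sinh (2 * J b) = x * x - inverse x * inverse x"
    by (simp add: x_def sinh_field_def exp_minus[symmetric] exp_add[symmetric])
  have ab: "a \<le> b"
    using step by simp
  have right: "pinned_partition_function a (Suc b) J h u 1
      = (?W u 1 * x + ?W u (-1) * inverse x) * y"
    and left: "pinned_partition_function a (Suc b) J h u (-1)
      = (?W u 1 * inverse x + ?W u (-1) * x) * inverse y" for u
    by (simp_all add: pinned_partition_function_Suc[OF ab] x_def y_def exp_minus)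
  have alg: "(p * x + q * inverse x) * y * ((r * inverse x + s * x) * inverse y)
      - (p * inverse x + q * x) * inverse y * ((r * x + s * inverse x) * y)
      = (p * s - q * r) * (x * x - inverse x * inverse x)" for p q r s :: real
    using nz by (simp add: field_simps)
  show ?case
    unfolding right left alg step.IH using ab by (simp add: sinh)
qed

lemma expectation_gibbs:
  fixes f :: "(nat \<Rightarrow> real) \<Rightarrow> real"
  shows "measure_pmf.expectation (gibbs a b J h) f
    = (\<Sum>\<sigma>\<in>spin_configs a b. exp (- hamiltonian a b J h \<sigma>) * f \<sigma>) / partition_function a b J h"
proof -
  have "measure_pmf.expectation (gibbs a b J h) f
      = (\<Sum>\<sigma>\<in>spin_configs a b. pmf (gibbs a b J h) \<sigma> *\<^sub>R f \<sigma>)"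
    by (rule integral_measure_pmf[OF finite_spin_configs])
      (auto simp: set_pmf_iff pmf_gibbs split: if_splits)
  then show ?thesis
    by (simp add: pmf_gibbs sum_divide_distrib)
qed

lemma sum_spin_configs_end_spins:
  fixes J h :: "nat \<Rightarrow> real"
  assumes "a \<le> b"
  defines "W \<equiv> pinned_partition_function a b J h"
  shows "(\<Sum>\<sigma>\<in>spin_configs a b. exp (- hamiltonian a b J h \<sigma>) * F (\<sigma> a) (\<sigma> b))
    = W 1 1 * F 1 1 + W 1 (-1) * F 1 (-1) + W (-1) 1 * F (-1) 1 + W (-1) (-1) * F (-1) (-1)"
proof -
  have spin: "(\<sigma> a = 1 \<or> \<sigma> a = -1) \<and> (\<sigma> b = 1 \<or> \<sigma> b = -1)" if "\<sigma> \<in> spin_configs a b" for \<sigma>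
    using that assms(1) by (auto simp: spin_configs_def PiE_iff)
  show ?thesis
    unfolding W_def pinned_partition_function_def sum_distrib_right sum.distrib[symmetric]
    by (intro sum.cong refl) (use spin in fastforce)
qed

text \<open>Divided by the partition function, the four pinned partition functions with end spins
  in \<open>{-1, 1}\<close> are the joint law of the end spins, and a covariance of two
  \<open>{-1, 1}\<close>-valued variables is four times the determinant of their joint law.\<close>

lemma covariance_end_spins:
  assumes "a \<le> b"
  shows "covariance (gibbs a b J h) (\<lambda>\<sigma>. \<sigma> a) (\<lambda>\<sigma>. \<sigma> b)
    = 4 * (\<Prod>x\<in>{a..<b}. 2 * sinh (2 * J x)) / (partition_function a b J h)\<^sup>2"
proof -
  let ?W = "pinned_partition_function a b J h"
  define p q r s where "p = ?W 1 1" and "q = ?W 1 (-1)" and "r = ?W (-1) 1" and "s = ?W (-1) (-1)"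
  define Z where "Z = partition_function a b J h"
  note W = p_def[symmetric] q_def[symmetric] r_def[symmetric] s_def[symmetric]
  have Z: "Z = p + q + r + s"
    using sum_spin_configs_end_spins[OF assms, of J h "\<lambda>_ _. 1"]
    by (simp add: Z_def partition_function_def W)
  have Z_pos: "Z > 0"
    unfolding Z_def by (rule partition_function_pos)
  have E: "measure_pmf.expectation (gibbs a b J h) (\<lambda>\<sigma>. F (\<sigma> a) (\<sigma> b))
      = (p * F 1 1 + q * F 1 (-1) + r * F (-1) 1 + s * F (-1) (-1)) / Z" for F
    unfolding expectation_gibbs sum_spin_configs_end_spins[OF assms] W Z_def ..
  define m n where "m = (p + q - r - s) / Z" and "n = (p - q + r - s) / Z"
  have left: "measure_pmf.expectation (gibbs a b J h) (\<lambda>\<sigma>. \<sigma> a) = m"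
    and right: "measure_pmf.expectation (gibbs a b J h) (\<lambda>\<sigma>. \<sigma> b) = n"
    using E[of "\<lambda>u v. u"] E[of "\<lambda>u v. v"] by (simp_all add: m_def n_def)
  have mZ: "m * Z = p + q - r - s" and nZ: "n * Z = p - q + r - s"
    using Z_pos by (simp_all add: m_def n_def)
  have "covariance (gibbs a b J h) (\<lambda>\<sigma>. \<sigma> a) (\<lambda>\<sigma>. \<sigma> b)
      = (p * ((1 - m) * (1 - n)) + q * ((1 - m) * (- 1 - n))
         + r * ((- 1 - m) * (1 - n)) + s * ((- 1 - m) * (- 1 - n))) / Z"
    unfolding covariance_def left right by (rule E)
  also have "\<dots> = 4 * (p * s - q * r) / Z\<^sup>2"
  proof -
    \<comment> \<open>With the means given by \<open>m * Z\<close> and \<open>n * Z\<close> this is a polynomial identity, free of division.\<close>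
    have "(p * ((1 - m) * (1 - n)) + q * ((1 - m) * (- 1 - n))
         + r * ((- 1 - m) * (1 - n)) + s * ((- 1 - m) * (- 1 - n))) * Z = 4 * (p * s - q * r)"
      using mZ nZ unfolding Z by algebra
    then show ?thesis
      using Z_pos by (simp add: frac_eq_eq power2_eq_square)
  qed
  also have "p * s - q * r = (\<Prod>x\<in>{a..<b}. 2 * sinh (2 * J x))"
    using det_pinned_partition_function[OF assms] by (simp add: p_def q_def r_def s_def)
  finally show ?thesis
    by (simp add: Z_def)
qed

section \<open>The covariance bound\<close>

lemma partition_function_ge_constant_spins:
  assumes "a \<le> b"
  shows "exp (\<Sum>x\<in>{a..<b}. J x) * (exp (\<Sum>x\<in>{a..b}. h x) + exp (- (\<Sum>x\<in>{a..b}. h x)))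
    \<le> partition_function a b J h"
proof -
  define up down :: "nat \<Rightarrow> real" where "up = (\<lambda>x\<in>{a..b}. 1)" and "down = (\<lambda>x\<in>{a..b}. -1)"
  have "up a \<noteq> down a"
    using assms by (simp add: up_def down_def)
  then have ne: "up \<noteq> down"
    by auto
  have "(\<Sum>x\<in>{a..<b}. J x * up x * up (x + 1)) = (\<Sum>x\<in>{a..<b}. J x)"
    and "(\<Sum>x\<in>{a..<b}. J x * down x * down (x + 1)) = (\<Sum>x\<in>{a..<b}. J x)"
    and "(\<Sum>x\<in>{a..b}. h x * up x) = (\<Sum>x\<in>{a..b}. h x)"
    and "(\<Sum>x\<in>{a..b}. h x * down x) = - (\<Sum>x\<in>{a..b}. h x)"
    unfolding sum_negf[symmetric] by (auto simp: up_def down_def intro!: sum.cong)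
  then have "exp (\<Sum>x\<in>{a..<b}. J x) * (exp (\<Sum>x\<in>{a..b}. h x) + exp (- (\<Sum>x\<in>{a..b}. h x)))
      = (\<Sum>\<sigma>\<in>{up, down}. exp (- hamiltonian a b J h \<sigma>))"
    using ne by (simp add: hamiltonian_def exp_diff exp_minus exp_add field_simps)
  also have "\<dots> \<le> partition_function a b J h"
    unfolding partition_function_def
    by (rule sum_mono2[OF finite_spin_configs]) (auto simp: up_def down_def spin_configs_def)
  finally show ?thesis .
qed

lemma tanh_ratio_eq_sinh:
  fixes t :: real
  shows "4 * tanh t / (1 + tanh t)\<^sup>2 = 2 * sinh (2 * t) / (exp t)\<^sup>2"
proof -
  have "1 + tanh t = exp t / cosh t"
    by (simp add: tanh_def sinh_plus_cosh[symmetric] add_divide_distrib)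
  then show ?thesis
    by (simp add: tanh_def sinh_double power2_eq_square)
qed

text \<open>The lower bound \<open>Y\<close> for the partition function is the weight of the two constant
  configurations, with \<open>\<bar>s\<bar>\<close> weakened to the sum \<open>S\<close> of absolute values in the smaller of the
  two terms.\<close>

lemma covariance_end_spins_le:
  assumes "a \<le> b" and J: "\<And>x. x \<in> {a..<b} \<Longrightarrow> J x \<ge> 0"
  shows "covariance (gibbs a b J h) (\<lambda>\<sigma>. \<sigma> a) (\<lambda>\<sigma>. \<sigma> b)
    \<le> (\<Prod>x\<in>{a..<b}. 4 * tanh (J x) / (1 + tanh (J x))\<^sup>2)
       * (4 * exp (- 2 * \<bar>\<Sum>x\<in>{a..b}. h x\<bar>) / (1 + exp (- 2 * (\<Sum>x\<in>{a..b}. \<bar>h x\<bar>)))\<^sup>2)"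
proof -
  define s S K where "s = (\<Sum>x\<in>{a..b}. h x)" and "S = (\<Sum>x\<in>{a..b}. \<bar>h x\<bar>)"
    and "K = exp (\<Sum>x\<in>{a..<b}. J x)"
  define P where "P = (\<Prod>x\<in>{a..<b}. 2 * sinh (2 * J x))"
  define Y where "Y = K * (exp \<bar>s\<bar> * (1 + exp (- 2 * S)))"
  have P: "P \<ge> 0"
    unfolding P_def using J by (intro prod_nonneg) simp
  have "\<bar>s\<bar> \<le> S"
    unfolding s_def S_def by (rule sum_abs)
  then have "exp \<bar>s\<bar> * (1 + exp (- 2 * S)) \<le> exp \<bar>s\<bar> * (1 + exp (- 2 * \<bar>s\<bar>))"
    by (intro mult_left_mono) auto
  also have "\<dots> = exp s + exp (- s)"
    by (cases "s \<ge> 0") (simp_all add: distrib_left exp_add[symmetric])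
  finally have "Y \<le> K * (exp s + exp (- s))"
    unfolding Y_def by (intro mult_left_mono) (auto simp: K_def)
  also have "\<dots> \<le> partition_function a b J h"
    unfolding K_def s_def by (rule partition_function_ge_constant_spins[OF assms(1)])
  finally have Y_le: "Y \<le> partition_function a b J h" .
  have Y_pos: "Y > 0"
    by (simp add: Y_def K_def add_pos_pos)
  have "covariance (gibbs a b J h) (\<lambda>\<sigma>. \<sigma> a) (\<lambda>\<sigma>. \<sigma> b) \<le> 4 * P / Y\<^sup>2"
    unfolding covariance_end_spins[OF assms(1)] P_def[symmetric]
    using P Y_pos Y_le by (intro divide_left_mono power_mono mult_pos_pos zero_less_power) auto
  also have "\<dots> = P / K\<^sup>2 * (4 * exp (- 2 * \<bar>s\<bar>) / (1 + exp (- 2 * S))\<^sup>2)"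
  proof -
    have "exp (- 2 * \<bar>s\<bar>) = inverse ((exp \<bar>s\<bar>)\<^sup>2)"
      by (simp add: exp_minus exp_double)
    then show ?thesis
      by (simp add: Y_def power_mult_distrib divide_inverse)
  qed
  also have "P / K\<^sup>2 = (\<Prod>x\<in>{a..<b}. 4 * tanh (J x) / (1 + tanh (J x))\<^sup>2)"
    unfolding P_def K_def tanh_ratio_eq_sinh prod_dividef
    by (simp add: exp_sum prod_power_distrib)
  finally show ?thesis
    unfolding s_def S_def .
qed

theorem theorem1p2:
  fixes N i j :: nat and J h :: "nat \<Rightarrow> real" and hi' hj' :: real
  assumes "N \<ge> 1"
    and "\<And>x. x < N \<Longrightarrow> J x \<ge> 0"
    and "i < j" and "j \<le> N"
    and "effective_fields N J h i j hi' hj'"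
  shows "covariance (gibbs 0 N J h) (\<lambda>\<sigma>. \<sigma> i) (\<lambda>\<sigma>. \<sigma> j)
    \<le> (\<Prod>x\<in>{i..<j}. 4 * tanh (J x) / (1 + tanh (J x))\<^sup>2)
       * (4 * exp (- 2 * \<bar>hi' + (\<Sum>x\<in>{i<..<j}. h x) + hj'\<bar>)
          / (1 + exp (- 2 * (\<bar>hi'\<bar> + (\<Sum>x\<in>{i<..<j}. \<bar>h x\<bar>) + \<bar>hj'\<bar>)))\<^sup>2)"
proof -
  let ?g = "h(i := hi', j := hj')"
  have marginal: "gibbs i j J ?g = map_pmf (\<lambda>\<sigma>. restrict \<sigma> {i..j}) (gibbs 0 N J h)"
    using assms(5) by (simp add: effective_fields_def)
  have cov: "covariance (gibbs 0 N J h) (\<lambda>\<sigma>. \<sigma> i) (\<lambda>\<sigma>. \<sigma> j)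
      = covariance (gibbs i j J ?g) (\<lambda>\<sigma>. \<sigma> i) (\<lambda>\<sigma>. \<sigma> j)"
    using assms(3) by (simp add: covariance_def marginal)
  have sites: "{i..j} = insert i (insert j {i<..<j})"
    using assms(3) by auto
  have inner: "(\<Sum>x\<in>{i<..<j}. f (?g x)) = (\<Sum>x\<in>{i<..<j}. f (h x))" for f :: "real \<Rightarrow> real"
    by (intro sum.cong) auto
  have fields: "(\<Sum>x\<in>{i..j}. f (?g x)) = f hi' + (\<Sum>x\<in>{i<..<j}. f (h x)) + f hj'"
    for f :: "real \<Rightarrow> real"
    using assms(3) inner[of f] by (simp add: sites)
  show ?thesis
    using covariance_end_spins_le[of i j J ?g] assms(2-4)
    unfolding cov fields[of "\<lambda>x. x"] fields[of abs] by simp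
qed

end
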